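(* Let $\mathcal X=\mathbb R^d$ ($1\le d<+\infty$) with Euclidean norm $\|\cdot\|$, let $\mathcal Y$ be a real separable Hilbert space and $A:\mathcal X\to\mathcal Y$ a linear operator with $\|A\|_{\mathrm{op}}\le1$. Let $X,\varepsilon$ be random variables with values in $\mathcal X$ and $\mathcal Y$ respectively, with $\|X\|\le1$ a.s., and let $Y=AX+\varepsilon$ a.s. Assume: (i) $\mathbb E[\varepsilon|X]=0$ and there is $\tau>0$ with $\mathbb E[\|\varepsilon\|_{\mathcal Y}^2|X]\le\tau^2$; (ii) $J:\mathbb R^d\to\mathbb R$ is given by $J(x)=|Gx|$, where $|\cdot|$ is a norm on $\mathbb R^m$ and $G:(\mathbb R^d,\|\cdot\|)\to(\mathbb R^m,|\cdot|)$ is a linear operator with $\|G\|_{\mathrm{op}}\le R$ for some $R>0$; (iii) there are a $\mathcal Y$-valued random variable $Z$, measurable with respect to the $\sigma$-algebra generated by $X$, and $\beta>0$, such that $A^*Z\in\partial J(X)$ a.s. and $\mathbb E[\|Z\|_{\mathcal Y}^2]\le\beta^2$; (iv) $\Lambda=\{\lambda_1,\dots,\lambda_N\}$ with $N\ge2$, $0<\lambda_1\le\dots\le\lambda_N<\infty$, $\lambda_j=\lambda_1Q^{j-1}$ for $j=1,\dots,N$, where $Q=(\lambda_N/\lambda_1)^{1/(N-1)}$, and $\lambda_*=\tau/\beta\in[\lambda_1,\lambda_N]$. For each $\lambda\in(0,+\infty)$ let $f_\lambda:\mathcal Y\to\mathcal X$ be measurable and such that $X_\lambda:=f_\lambda(Y)$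 satisfies, almost surely, $$X_\lambda\in\arg\min_{x\in\mathbb R^d}\tfrac12\|Ax-Y\|_{\mathcal Y}^2+\lambda J(x).$$ Let $(Y_i,X_i)_{i=1}^n$ be independent copies of $(Y,X)$, put $X_\lambda^i=f_\lambda(Y_i)$, and let $$\widehat\lambda_\Lambda\in\arg\min_{\lambda\in\Lambda}\frac1n\sum_{i=1}^nD_J(X_i,X_\lambda^i),$$ and $L(X_\lambda)=\mathbb E[D_J(X,X_\lambda)]$. Let $\eta\in(0,1)$. Then, with probability at least $1-\eta$, $$L(X_{\widehat\lambda_\Lambda})\le\frac{1+Q^2}{Q}\beta\tau+\frac{13R}{n}\log\frac{2N}{\eta}.$$
   Context: $\partial J$ is the convex subdifferential. The Bregman divergence is $D_J(x,x')=J(x)-J(x')-\langle s_J(x'),x-x'\rangle$ with $s_J(x')\in\partial J(x')$ a chosen subgradient. Here the subgradient at the regularized solution is the one given by the optimality condition: $s_J(X_\lambda)=\frac1\lambda A^*(Y-AX_\lambda)\in\partial J(X_\lambda)$, so that $D_J(X,X_\lambda)=J(X)-J(X_\lambda)-\langle\frac1\lambda A^*(Y-AX_\lambda),X-X_\lambda\rangle$, and likewise $s_J(X_\lambda^i)=\frac1\lambda A^*(Y_i-AX_\lambda^i)$ in $D_J(X_i,X_\lambda^i)$. It is a standing assumption that the minimizers exist and can be selected measurably. The parameter $\widehat\lambda_\Lambda$ is a random variable depending on the sample, and $L(X_{\widehat\lambda_\Lambda})$ denotes the value of the deterministic function $\lambda\mapsto L(X_\lambda)$ at $\lambda=\widehat\lambda_\Lambda$;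 the probability is with respect to the sample. *)

theory Defs
  imports "HOL-Probability.Probability"
begin

definition is_norm :: "('v::real_vector \<Rightarrow> real) \<Rightarrow> bool" where
  "is_norm p \<longleftrightarrow>
     (\<forall>x. 0 \<le> p x) \<and> (\<forall>x. p x = 0 \<longleftrightarrow> x = 0) \<and>
     (\<forall>c x. p (c *\<^sub>R x) = \<bar>c\<bar> * p x) \<and> (\<forall>x y. p (x + y) \<le> p x + p y)"

text \<open>
  The operator norm of a map into a space carrying an arbitrary norm \<open>p\<close>, following the shape
  of \<^const>\<open>onorm\<close>. The supremum is the true one when the quotients are bounded, in particular
  for linear maps between finite-dimensional spaces.
\<close>

definition onorm_wrt :: "('w \<Rightarrow> real) \<Rightarrow> ('v::real_normed_vector \<Rightarrow> 'w) \<Rightarrow> real" where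
  "onorm_wrt p f = (SUP x. p (f x) / norm x)"

lemma onorm_wrt_norm: "onorm_wrt norm f = onorm f"
  by (simp add: onorm_wrt_def onorm_def)

definition subdifferential :: "('v::real_inner \<Rightarrow> real) \<Rightarrow> 'v \<Rightarrow> 'v set" where
  "subdifferential J x = {s. \<forall>z. J x + s \<bullet> (z - x) \<le> J z}"

text \<open>The argument \<open>s\<close> is the subgradient chosen at the second point \<open>x'\<close>.\<close>

definition bregman :: "('v::real_inner \<Rightarrow> real) \<Rightarrow> 'v \<Rightarrow> 'v \<Rightarrow> 'v \<Rightarrow> real" where
  "bregman J s x x' = J x - J x' - s \<bullet> (x - x')"

text \<open>
  If \<open>x\<close> minimizes \<open>\<lambda>x. \<parallel>A x - y\<parallel>\<^sup>2 / 2 + l * J x\<close> with \<open>l > 0\<close>, then the first-order optimality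
  condition says that this vector is a subgradient of \<open>J\<close> at \<open>x\<close>.
\<close>

definition opt_subgrad ::
    "('v::real_inner \<Rightarrow> 'y::real_inner) \<Rightarrow> real \<Rightarrow> 'y \<Rightarrow> 'v \<Rightarrow> 'v" where
  "opt_subgrad A l y x = (1 / l) *\<^sub>R adjoint A (y - A x)"

text \<open>
  The library states this for Euclidean codomains only; the Hilbert-space version
  shows that \<^const>\<open>adjoint\<close> is well defined here.
\<close>

lemma adjoint_works_inner:
  fixes f :: "'v::euclidean_space \<Rightarrow> 'y::real_inner"
  assumes "linear f"
  shows "x \<bullet> adjoint f y = f x \<bullet> y"
proof -
  define g where "g y = (\<Sum>b\<in>Basis. (f b \<bullet> y) *\<^sub>R b)" for y
  have "f x \<bullet> y = x \<bullet> g y" for x y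
  proof -
    have "f x \<bullet> y = f (\<Sum>b\<in>Basis. (x \<bullet> b) *\<^sub>R b) \<bullet> y"
      by (simp add: euclidean_representation)
    also have "\<dots> = (\<Sum>b\<in>Basis. (x \<bullet> b) * (f b \<bullet> y))"
      by (simp add: linear_sum[OF assms] linear_cmul[OF assms] inner_sum_left)
    also have "\<dots> = x \<bullet> g y"
      by (simp add: g_def inner_sum_right mult.commute)
    finally show ?thesis .
  qed
  then have "adjoint f = g"
    by (intro adjoint_unique) blast
  with \<open>f x \<bullet> y = x \<bullet> g y\<close> show ?thesis by simp
qed

definition sigma_gen :: "'o measure \<Rightarrow> ('o \<Rightarrow> 'v::topological_space) \<Rightarrow> 'o measure" where
  "sigma_gen M X = vimage_algebra (space M) X borel"

text \<open>
  \<^const>\<open>real_cond_exp\<close> only treats real-valued functions. For Banach-space-valued \<open>f\<close>,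
  \<open>has_cond_exp M F f g\<close> says that \<open>g\<close> is a version of the conditional expectation of \<open>f\<close>
  given \<open>F\<close>.
\<close>

definition has_cond_exp ::
    "'o measure \<Rightarrow> 'o measure \<Rightarrow> ('o \<Rightarrow> 'y::{banach, second_countable_topology}) \<Rightarrow> ('o \<Rightarrow> 'y) \<Rightarrow> bool"
  where
  "has_cond_exp M F f g \<longleftrightarrow>
     subalgebra M F \<and> integrable M f \<and> integrable M g \<and> g \<in> borel_measurable F \<and>
     (\<forall>B\<in>sets F. (LINT \<omega>:B|M. f \<omega>) = (LINT \<omega>:B|M. g \<omega>))"

lemma has_cond_exp_real:
  fixes f g :: "'o \<Rightarrow> real"
  assumes "sigma_finite_subalgebra M F" "has_cond_exp M F f g"
  shows "AE \<omega> in M. real_cond_exp M F f \<omega> = g \<omega>"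
  using assms
  by (intro sigma_finite_subalgebra.real_cond_exp_charact) (auto simp: has_cond_exp_def)

end

theory Submission
  imports Defs
begin

text \<open>
  Because \<open>J\<close> is positively homogeneous, a subgradient \<open>s\<close> of \<open>J\<close> at \<open>x'\<close> satisfies
  \<open>s \<bullet> x' = J x'\<close>. Hence the Bregman divergence is \<open>J x - s \<bullet> x\<close> and lies in \<open>[0, 2 * R]\<close> when
  \<open>norm x \<le> 1\<close>. Exponential moments of such a variable, divided by \<open>2 * R\<close>, give a multiplicative
  concentration bound for the empirical risk. Used from below at every grid point and from above at
  a single one, \<open>l\<close>, it bounds the risk of the selected parameter by
  \<open>exp 1 * L l + 8 * R / n * ln (2 * N / \<eta>)\<close>.
  Adding the divergence with the arguments exchanged turns the source condition into
  \<open>L l \<le> (l * \<beta>\<^sup>2 + \<tau>\<^sup>2 / l) / 4\<close>. Some grid point \<open>l\<close> is within a factor \<open>Q\<close> of \<open>\<tau> / \<beta>\<close>, and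
  \<open>exp 1 \<le> 4\<close> leaves room to absorb the remaining constants.
\<close>

section \<open>Subgradients and Bregman divergences of seminorms\<close>

text \<open>The function \<open>p (G x)\<close> vanishes on the kernel of \<open>G\<close>, so a
  seminorm is the right abstraction; \<open>le_norm\<close> carries the bound on the operator norm
  of \<open>G\<close>.\<close>

locale bounded_seminorm =
  fixes J :: "'v::real_inner \<Rightarrow> real" and R :: real
  assumes scale: "J (c *\<^sub>R x) = \<bar>c\<bar> * J x"
    and triangle: "J (x + y) \<le> J x + J y"
    and le_norm: "J x \<le> R * norm x"
begin

lemma uminus: "J (- x) = J x"
  using scale[of "-1" x] by simp

lemma nonneg: "0 \<le> J x"
  using triangle[of x "- x"] scale[of 0 x] by (simp add: uminus)

text \<open>Testing the subgradient inequality at \<open>0\<close> and at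
  \<open>2 *\<^sub>R x\<close> bounds \<open>s \<bullet> x\<close> by \<open>J x\<close> from both
  sides; the resulting equality removes the base point from the inequality.\<close>

lemma subgradient_le: "s \<in> subdifferential J x \<Longrightarrow> s \<bullet> z \<le> J z"
  and subgradient_self: "s \<in> subdifferential J x \<Longrightarrow> s \<bullet> x = J x"
proof -
  assume "s \<in> subdifferential J x"
  then have s: "J x + s \<bullet> (z - x) \<le> J z" for z
    by (simp add: subdifferential_def)
  have "J x \<le> s \<bullet> x"
    \<comment> \<open>Writing the origin as \<open>0 *\<^sub>R x\<close> lets \<open>scale\<close>
      evaluate \<open>J\<close> there to \<open>0\<close>.\<close>
    using s[of "0 *\<^sub>R x"] by (simp add: scale del: scaleR_zero_left) simp
  moreover have "s \<bullet> x \<le> J x"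
    using s[of "2 *\<^sub>R x"] by (simp add: scale inner_diff_right)
  ultimately show eq: "s \<bullet> x = J x" by simp
  show "s \<bullet> z \<le> J z"
    using s[of z] eq by (simp add: inner_diff_right)
qed

lemma bregman_nonneg:
  assumes "s \<in> subdifferential J x'"
  shows "0 \<le> bregman J s x x'"
  using assms by (simp add: bregman_def subdifferential_def algebra_simps)

text \<open>The terms in \<open>x'\<close> cancel, and the subgradient tested at \<open>- x\<close>
  costs one more \<open>J x\<close>.\<close>

lemma bregman_le:
  assumes "s \<in> subdifferential J x'"
  shows "bregman J s x x' \<le> 2 * R * norm x"
proof -
  have "bregman J s x x' = J x + s \<bullet> (- x)"
    using subgradient_self[OF assms] by (simp add: bregman_def inner_diff_right)
  also have "\<dots> \<le> 2 * J x"
    using subgradient_le[OF assms, of "- x"] by (simp add: uminus)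
  finally show ?thesis
    using le_norm[of x] by simp
qed

lemma continuous: "continuous_on UNIV J"
proof -
  have *: "J x \<le> J y + R * norm (x - y)" for x y
    using triangle[of y "x - y"] le_norm[of "x - y"] by simp
  have "\<bar>J x - J y\<bar> \<le> \<bar>R\<bar> * norm (x - y)" for x y
  proof -
    have "R * norm (x - y) \<le> \<bar>R\<bar> * norm (x - y)"
      by (simp add: mult_right_mono)
    then show ?thesis
      using *[of x y] *[of y x] by (simp add: norm_minus_commute)
  qed
  then have "\<bar>R\<bar>-lipschitz_on UNIV J"
    by (intro lipschitz_onI) (auto simp: dist_norm)
  then show ?thesis
    by (rule lipschitz_on_continuous_on)
qed

end

section \<open>First-order optimality and the deterministic source bound\<close>

text \<open>The minimizer is compared with the points of the segment towards \<open>z\<close>.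
  Convexity of \<open>J\<close> makes the comparison linear in \<open>t\<close> up to a quadratic
  term, which disappears after division by \<open>t\<close> and passage to the limit
  \<open>t = 0\<close>.\<close>

lemma opt_subgrad_in_subdifferential:
  fixes A :: "'v::euclidean_space \<Rightarrow> 'y::real_inner"
  assumes J: "bounded_seminorm J R" and A: "linear A" and l: "0 < l"
    and min: "\<And>z. 1/2 * (norm (A x - y))\<^sup>2 + l * J x \<le> 1/2 * (norm (A z - y))\<^sup>2 + l * J z"
  shows "opt_subgrad A l y x \<in> subdifferential J x"
proof -
  interpret bounded_seminorm J R by (rule J)
  have "J x + opt_subgrad A l y x \<bullet> (z - x) \<le> J z" for z
  proof -
    define h where "h = A (z - x)"
    \<comment> \<open>The coefficient of \<open>t\<close> in the comparison; the claim amounts to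
      \<open>0 \<le> c\<close>.\<close>
    define c where "c = (A x - y) \<bullet> h + l * (J z - J x)"
    have "- (h \<bullet> h / 2) * t \<le> c" if t: "0 < t" "t \<le> 1" for t :: real
    proof -
      have "J ((1 - t) *\<^sub>R x + t *\<^sub>R z) \<le> (1 - t) * J x + t * J z"
        using triangle[of "(1 - t) *\<^sub>R x" "t *\<^sub>R z"] t by (simp add: scale)
      then have "l * J ((1 - t) *\<^sub>R x + t *\<^sub>R z) \<le> l * ((1 - t) * J x + t * J z)"
        using l by simp
      moreover have eq: "A ((1 - t) *\<^sub>R x + t *\<^sub>R z) - y = (A x - y) + t *\<^sub>R h"
        by (simp add: h_def linear_add[OF A] linear_diff[OF A] linear_cmul[OF A] algebra_simps)
      ultimately have "(norm (A x - y))\<^sup>2 / 2 + l * J x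
          \<le> (norm ((A x - y) + t *\<^sub>R h))\<^sup>2 / 2 + l * ((1 - t) * J x + t * J z)"
        using min[of "(1 - t) *\<^sub>R x + t *\<^sub>R z", unfolded eq] by linarith
      moreover have "(norm ((A x - y) + t *\<^sub>R h))\<^sup>2
          = (norm (A x - y))\<^sup>2 + 2 * t * ((A x - y) \<bullet> h) + t * t * (h \<bullet> h)"
        unfolding power2_norm_eq_inner
        by (simp only: inner_add_left inner_add_right inner_scaleR_left inner_scaleR_right
            inner_commute[of h "A x - y"]) (simp add: algebra_simps)
      ultimately have "0 \<le> t * (c + t * (h \<bullet> h / 2))"
        by (simp add: c_def algebra_simps)
      then have "0 \<le> c + t * (h \<bullet> h / 2)"
        using t by (simp add: zero_le_mult_iff)
      then show ?thesis
        by (simp add: mult.commute)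
    qed
    then have "\<forall>\<^sub>F t in at_right 0. - (h \<bullet> h / 2) * t \<le> c"
      by (auto simp: eventually_at_right_field intro!: exI[of _ 1])
    moreover have "((\<lambda>t. - (h \<bullet> h / 2) * t) \<longlongrightarrow> - (h \<bullet> h / 2) * 0) (at_right 0)"
      by (intro tendsto_intros)
    ultimately have "0 \<le> c"
      using tendsto_upperbound[of "\<lambda>t. - (h \<bullet> h / 2) * t" "- (h \<bullet> h / 2) * 0" "at_right 0" c]
      by simp
    moreover have "opt_subgrad A l y x \<bullet> (z - x) = (y - A x) \<bullet> h / l"
      using adjoint_works_inner[OF A, of "z - x" "y - A x"]
      by (simp add: opt_subgrad_def h_def inner_commute)
    ultimately have "l * (opt_subgrad A l y x \<bullet> (z - x)) \<le> l * (J z - J x)"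
      using l by (simp add: c_def inner_diff_left)
    then show ?thesis
      using l by simp
  qed
  then show ?thesis
    by (simp add: subdifferential_def)
qed

text \<open>Moving the adjoint across the inner product leaves an expression in \<open>J\<close> and
  \<open>A\<close> alone, which is easy to estimate and to show measurable.\<close>

lemma bregman_opt_subgrad:
  fixes A :: "'v::euclidean_space \<Rightarrow> 'y::real_inner"
  assumes "linear A"
  shows "bregman J (opt_subgrad A l y x') x x' = J x - J x' - (y - A x') \<bullet> A (x - x') / l"
  using adjoint_works_inner[OF assms, of "x - x'" "y - A x'"]
  by (simp add: bregman_def opt_subgrad_def inner_commute)

text \<open>The source subgradient gives \<open>J x - J x' \<le> z \<bullet> h\<close> with
  \<open>h = A (x - x')\<close>. What remains is a concave quadratic in \<open>h\<close>, and the
  right-hand side is its maximum. The cross term in \<open>z\<close> and \<open>e\<close> is kept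
  because it has mean zero later.\<close>

lemma bregman_le_source:
  fixes A :: "'v::euclidean_space \<Rightarrow> 'y::real_inner"
  assumes A: "linear A" and l: "0 < l" and z: "adjoint A z \<in> subdifferential J x"
  shows "bregman J (opt_subgrad A l (A x + e) x') x x'
    \<le> l / 4 * (norm z)\<^sup>2 - (z \<bullet> e) / 2 + (norm e)\<^sup>2 / (4 * l)"
proof -
  define h where "h = A (x - x')"
  have "J x + adjoint A z \<bullet> (x' - x) \<le> J x'"
    using z by (simp add: subdifferential_def)
  moreover have "adjoint A z \<bullet> (x' - x) = - (z \<bullet> h)"
    using adjoint_works_inner[OF A, of "x' - x" z]
    by (simp add: h_def inner_commute linear_diff[OF A] inner_diff_right)
  moreover have eq: "A x + e - A x' = h + e"
    by (simp add: h_def linear_diff[OF A])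
  ultimately have le: "bregman J (opt_subgrad A l (A x + e) x') x x' \<le> z \<bullet> h - (h + e) \<bullet> h / l"
    unfolding bregman_opt_subgrad[OF A] eq h_def[symmetric] by linarith
  \<comment> \<open>Completing the square: the vector is \<open>- l\<close> times the gradient in
    \<open>h\<close> of \<open>z \<bullet> h - (h + e) \<bullet> h / l\<close>.\<close>
  have "0 \<le> (2 *\<^sub>R h + e - l *\<^sub>R z) \<bullet> (2 *\<^sub>R h + e - l *\<^sub>R z) / (4 * l)"
    using l by simp
  also have "\<dots> = (4 * (h \<bullet> h) + e \<bullet> e + l * l * (z \<bullet> z) + 4 * (e \<bullet> h) - 4 * l * (z \<bullet> h)
      - 2 * l * (z \<bullet> e)) / (4 * l)"
    by (simp add: inner_add_left inner_add_right inner_diff_left inner_diff_right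
        inner_commute[of h e] inner_commute[of h z] inner_commute[of e z] algebra_simps)
  also have "\<dots> = (l / 4 * (z \<bullet> z) - (z \<bullet> e) / 2 + (e \<bullet> e) / (4 * l)) - (z \<bullet> h - (h + e) \<bullet> h / l)"
    using l by (simp add: inner_add_left field_simps)
  finally show ?thesis
    using le by (simp add: power2_norm_eq_inner)
qed

text \<open>Expansion in the basis shows that the quotients in \<open>onorm_wrt\<close> are bounded,
  so the supremum really dominates each of them.\<close>

lemma bounded_seminorm_norm_linear:
  fixes G :: "'v::euclidean_space \<Rightarrow> 'w::real_vector"
  assumes p: "is_norm p" and G: "linear G" and R: "onorm_wrt p G \<le> R"
  shows "bounded_seminorm (\<lambda>x. p (G x)) R"
proof
  have scale: "p (c *\<^sub>R x) = \<bar>c\<bar> * p x" and triangle: "p (x + y) \<le> p x + p y" for c x y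
    using p by (auto simp: is_norm_def)
  have nonneg: "0 \<le> p x" and zero: "p 0 = 0" for x
    using p by (auto simp: is_norm_def)
  show "p (G (c *\<^sub>R x)) = \<bar>c\<bar> * p (G x)" for c x
    by (simp add: linear_cmul[OF G] scale)
  show "p (G (x + y)) \<le> p (G x) + p (G y)" for x y
    by (simp add: linear_add[OF G] triangle)
  have psum: "p (\<Sum>b\<in>B. g b) \<le> (\<Sum>b\<in>B. p (g b))" if "finite B" for g :: "'v \<Rightarrow> 'w" and B
    using that
  proof induction
    case (insert b B)
    then show ?case using triangle[of "g b" "\<Sum>b\<in>B. g b"] by simp
  qed (simp add: zero)
  have bound: "p (G x) \<le> (\<Sum>b\<in>Basis. p (G b)) * norm x" for x
  proof -
    have "G x = G (\<Sum>b\<in>Basis. (x \<bullet> b) *\<^sub>R b)"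
      by (simp add: euclidean_representation)
    also have "\<dots> = (\<Sum>b\<in>Basis. (x \<bullet> b) *\<^sub>R G b)"
      by (simp add: linear_sum[OF G] linear_cmul[OF G])
    also have "p \<dots> \<le> (\<Sum>b\<in>Basis. p ((x \<bullet> b) *\<^sub>R G b))"
      by (rule psum) simp
    also have "\<dots> \<le> (\<Sum>b\<in>Basis. norm x * p (G b))"
      by (intro sum_mono) (simp add: scale nonneg mult_right_mono Basis_le_norm)
    finally show ?thesis
      by (simp add: sum_distrib_left mult.commute)
  qed
  have "bdd_above (range (\<lambda>x. p (G x) / norm x))"
  proof (rule bdd_aboveI2)
    show "p (G x) / norm x \<le> (\<Sum>b\<in>Basis. p (G b))" for x
      using bound[of x] by (cases "x = 0") (simp_all add: sum_nonneg nonneg divide_le_eq)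
  qed
  then have "p (G x) / norm x \<le> R" for x
    using cSUP_upper[of x UNIV "\<lambda>x. p (G x) / norm x"] R by (simp add: onorm_wrt_def)
  then show "p (G x) \<le> R * norm x" for x
    by (cases "x = 0") (simp_all add: linear_0[OF G] zero divide_le_eq)
qed

text \<open>The largest grid point not exceeding \<open>u\<close> works: its successor, if there is
  one, is \<open>Q\<close> times as large and exceeds \<open>u\<close>.\<close>

lemma geometric_grid_point:
  fixes a :: "nat \<Rightarrow> real"
  assumes "N \<ge> 1" and Q: "1 \<le> Q" and pos: "0 < a 1"
    and a: "\<And>j. j \<in> {1..N} \<Longrightarrow> a j = a 1 * Q ^ (j - 1)"
    and u: "u \<in> {a 1..a N}"
  obtains k where "k \<in> {1..N}" "a k \<le> u" "u \<le> Q * a k"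
proof -
  define S where "S = {j \<in> {1..N}. a j \<le> u}"
  define k where "k = Max S"
  have "finite S" "1 \<in> S"
    using \<open>N \<ge> 1\<close> u by (auto simp: S_def)
  then have k: "k \<in> S" and max: "\<And>j. j \<in> S \<Longrightarrow> j \<le> k"
    unfolding k_def using Max_in by auto
  have "a k > 0" using k a[of k] pos Q by (auto simp: S_def)
  show ?thesis
  proof (rule that[of k])
    show "k \<in> {1..N}" "a k \<le> u" using k by (auto simp: S_def)
    show "u \<le> Q * a k"
    proof (cases "k = N")
      case True
      have "1 * a k \<le> Q * a k" using Q \<open>a k > 0\<close> by (intro mult_right_mono) auto
      then show ?thesis using u True by simp
    next
      case False
      with k have "Suc k \<in> {1..N}" by (auto simp: S_def)
      moreover have "Suc k \<notin> S" using max[of "Suc k"] by auto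
      ultimately have "u < a (Suc k)" by (auto simp: S_def)
      also have "\<dots> = Q * a k"
        using a[OF \<open>Suc k \<in> {1..N}\<close>] a[of k] k by (cases k) (auto simp: S_def)
      finally show ?thesis by simp
    qed
  qed
qed

section \<open>Conditional expectations and second moments\<close>

text \<open>For a simple \<open>F\<close>-measurable function the integral splits over level sets,
  on each of which \<open>\<epsilon>\<close> integrates to zero. Dominated convergence extends this
  to \<open>Z\<close>.\<close>

lemma integral_inner_cond_exp_zero:
  fixes \<epsilon> Z :: "'o \<Rightarrow> 'y::{real_inner, banach, second_countable_topology}"
  assumes ce: "has_cond_exp M F \<epsilon> (\<lambda>_. 0)" and Z: "Z \<in> borel_measurable F"
    and int: "integrable M (\<lambda>\<omega>. norm (Z \<omega>) * norm (\<epsilon> \<omega>))"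
  shows "(\<integral>\<omega>. Z \<omega> \<bullet> \<epsilon> \<omega> \<partial>M) = 0"
proof -
  have sub: "subalgebra M F" and eps: "integrable M \<epsilon>"
    and null: "\<And>B. B \<in> sets F \<Longrightarrow> (LINT \<omega>:B|M. \<epsilon> \<omega>) = 0"
    using ce by (auto simp: has_cond_exp_def set_lebesgue_integral_def)
  note [measurable] = borel_measurable_integrable[OF eps]
  have space: "space F = space M" and sets: "sets F \<subseteq> sets M"
    using sub by (auto simp: subalgebra_def)
  have [measurable]: "Z \<in> borel_measurable M"
    by (rule measurable_from_subalg[OF sub Z])
  obtain s where s: "\<And>i. simple_function F (s i)"
      and lim: "\<And>\<omega>. \<omega> \<in> space M \<Longrightarrow> (\<lambda>i. s i \<omega>) \<longlonglongrightarrow> Z \<omega>"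
      and bound: "\<And>i \<omega>. \<omega> \<in> space M \<Longrightarrow> norm (s i \<omega>) \<le> 2 * norm (Z \<omega>)"
    \<comment> \<open>Approximation centred at \<open>0\<close> turns the distance bound into a norm
      bound, which provides the dominating function.\<close>
    using borel_measurable_implies_sequence_metric[OF Z, of 0] by (simp add: space) metis
  have s_meas [measurable]: "s i \<in> borel_measurable M" for i
    by (rule measurable_from_subalg[OF sub borel_measurable_simple_function[OF s]])
  have zero: "(\<integral>\<omega>. s i \<omega> \<bullet> \<epsilon> \<omega> \<partial>M) = 0" for i
  proof -
    let ?V = "s i ` space M"
    let ?B = "\<lambda>v. s i -` {v} \<inter> space M"
    have fin: "finite ?V" and B: "?B v \<in> sets F" for v
      using simple_functionD[OF s[of i]] by (simp_all add: space)
    have BM: "?B v \<in> sets M" for v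
      using B sets by auto
    have intB: "integrable M (\<lambda>\<omega>. indicator (?B v) \<omega> *\<^sub>R \<epsilon> \<omega>)" for v
      by (rule integrable_mult_indicator[OF BM eps])
    have "(\<integral>\<omega>. s i \<omega> \<bullet> \<epsilon> \<omega> \<partial>M)
        = (\<integral>\<omega>. (\<Sum>v\<in>?V. v \<bullet> (indicator (?B v) \<omega> *\<^sub>R \<epsilon> \<omega>)) \<partial>M)"
    proof (rule Bochner_Integration.integral_cong[OF refl])
      fix \<omega> assume \<omega>: "\<omega> \<in> space M"
      have "(\<Sum>v\<in>?V. v \<bullet> (indicator (?B v) \<omega> *\<^sub>R \<epsilon> \<omega>))
          = (\<Sum>v\<in>?V. if v = s i \<omega> then v \<bullet> \<epsilon> \<omega> else 0)"
        using \<omega> by (intro sum.cong) (auto simp: indicator_def)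
      also have "\<dots> = s i \<omega> \<bullet> \<epsilon> \<omega>"
        using fin \<omega> by simp
      finally show "s i \<omega> \<bullet> \<epsilon> \<omega> = (\<Sum>v\<in>?V. v \<bullet> (indicator (?B v) \<omega> *\<^sub>R \<epsilon> \<omega>))" by simp
    qed
    also have "\<dots> = (\<Sum>v\<in>?V. v \<bullet> (\<integral>\<omega>. indicator (?B v) \<omega> *\<^sub>R \<epsilon> \<omega> \<partial>M))"
      using intB by (simp del: inner_scaleR_right)
    also have "\<dots> = 0"
      using null[OF B] by (simp add: set_lebesgue_integral_def)
    finally show ?thesis .
  qed
  have "(\<lambda>i. \<integral>\<omega>. s i \<omega> \<bullet> \<epsilon> \<omega> \<partial>M) \<longlonglongrightarrow> (\<integral>\<omega>. Z \<omega> \<bullet> \<epsilon> \<omega> \<partial>M)"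
  proof (rule integral_dominated_convergence[where w = "\<lambda>\<omega>. 2 * (norm (Z \<omega>) * norm (\<epsilon> \<omega>))"])
    show "AE \<omega> in M. (\<lambda>i. s i \<omega> \<bullet> \<epsilon> \<omega>) \<longlonglongrightarrow> Z \<omega> \<bullet> \<epsilon> \<omega>"
      using lim by (intro AE_I2 tendsto_inner tendsto_const)
    show "AE \<omega> in M. norm (s i \<omega> \<bullet> \<epsilon> \<omega>) \<le> 2 * (norm (Z \<omega>) * norm (\<epsilon> \<omega>))" for i
    proof (rule AE_I2)
      fix \<omega> assume "\<omega> \<in> space M"
      have "norm (s i \<omega> \<bullet> \<epsilon> \<omega>) \<le> norm (s i \<omega>) * norm (\<epsilon> \<omega>)"
        by (simp add: Cauchy_Schwarz_ineq2)
      also have "\<dots> \<le> 2 * norm (Z \<omega>) * norm (\<epsilon> \<omega>)"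
        using bound[OF \<open>\<omega> \<in> space M\<close>] by (intro mult_right_mono) auto
      finally show "norm (s i \<omega> \<bullet> \<epsilon> \<omega>) \<le> 2 * (norm (Z \<omega>) * norm (\<epsilon> \<omega>))" by simp
    qed
  qed (use int in auto)
  then show ?thesis
    by (simp add: zero LIMSEQ_const_iff)
qed

lemma second_moment_le:
  fixes g :: "'o \<Rightarrow> 'a::{real_normed_vector, second_countable_topology}"
  assumes "g \<in> borel_measurable M" and "(\<integral>\<^sup>+\<omega>. ennreal ((norm (g \<omega>))\<^sup>2) \<partial>M) \<le> ennreal c" and "0 \<le> c"
  shows "integrable M (\<lambda>\<omega>. (norm (g \<omega>))\<^sup>2)" and "(\<integral>\<omega>. (norm (g \<omega>))\<^sup>2 \<partial>M) \<le> c"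
proof -
  have [measurable]: "g \<in> borel_measurable M" by fact
  show int: "integrable M (\<lambda>\<omega>. (norm (g \<omega>))\<^sup>2)"
    using assms(2) by (intro integrableI_nonneg) (auto simp: le_less_trans[OF _ ennreal_less_top])
  show "(\<integral>\<omega>. (norm (g \<omega>))\<^sup>2 \<partial>M) \<le> c"
    using assms(2,3) by (simp add: nn_integral_eq_integral[OF int])
qed

section \<open>Exponential concentration for bounded independent variables\<close>

text \<open>Markov's inequality is applied to the exponential of the sum, whose expectation
  factorizes by independence.\<close>

lemma (in prob_space) chernoff_sum:
  fixes U :: "'i \<Rightarrow> 'a \<Rightarrow> real"
  assumes indep: "indep_vars (\<lambda>_. borel) U I" and fin: "finite I"
    and int: "\<And>i. i \<in> I \<Longrightarrow> integrable M (\<lambda>\<omega>. exp (U i \<omega>))"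
    and le: "\<And>i. i \<in> I \<Longrightarrow> expectation (\<lambda>\<omega>. exp (U i \<omega>)) \<le> exp c"
  shows "prob {\<omega> \<in> space M. real (card I) * c + K \<le> (\<Sum>i\<in>I. U i \<omega>)} \<le> exp (- K)"
proof -
  have indep': "indep_vars (\<lambda>_. borel) (\<lambda>i \<omega>. exp (U i \<omega>)) I"
    by (rule indep_vars_compose2[OF indep]) simp
  have prod_int: "integrable M (\<lambda>\<omega>. \<Prod>i\<in>I. exp (U i \<omega>))"
    using fin indep' int by (rule indep_vars_integrable)
  have "{\<omega> \<in> space M. real (card I) * c + K \<le> (\<Sum>i\<in>I. U i \<omega>)}
      = {\<omega> \<in> space M. exp (real (card I) * c + K) \<le> (\<Prod>i\<in>I. exp (U i \<omega>))}"
    by (simp flip: exp_sum[OF fin])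
  also have "prob \<dots>
      \<le> expectation (\<lambda>\<omega>. \<Prod>i\<in>I. exp (U i \<omega>)) / exp (real (card I) * c + K)"
    by (rule integral_Markov_inequality_measure[OF prod_int, of "{}"]) (simp_all add: prod_nonneg)
  also have "expectation (\<lambda>\<omega>. \<Prod>i\<in>I. exp (U i \<omega>)) = (\<Prod>i\<in>I. expectation (\<lambda>\<omega>. exp (U i \<omega>)))"
    using fin indep' int by (rule indep_vars_lebesgue_integral)
  also have "\<dots> \<le> (\<Prod>i\<in>I. exp c)"
    using le by (intro prod_mono) auto
  also have "\<dots> = exp (real (card I) * c)"
    by (simp add: exp_of_nat_mult)
  also have "exp (real (card I) * c) / exp (real (card I) * c + K) = exp (- K)"
    by (simp flip: exp_diff)
  finally show ?thesis
    by (simp add: divide_right_mono)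
qed

lemma exp_le_chord:
  fixes a w :: real
  assumes "0 \<le> w" "w \<le> 1"
  shows "exp (a * w) \<le> 1 + (exp a - 1) * w"
  using convex_onD[OF exp_convex, of w 0 a] assms by (simp add: algebra_simps)

text \<open>The chord bound makes the estimate depend on \<open>W\<close> only through its mean,
  followed by \<open>1 + x \<le> exp x\<close>. This Poisson-type bound is what makes the
  concentration multiplicative.\<close>

lemma (in prob_space) expectation_exp_le:
  fixes W :: "'a \<Rightarrow> real"
  assumes [measurable]: "W \<in> borel_measurable M" and W: "AE \<omega> in M. 0 \<le> W \<omega> \<and> W \<omega> \<le> 1"
  shows "integrable M (\<lambda>\<omega>. exp (a * W \<omega>))"
    and "expectation (\<lambda>\<omega>. exp (a * W \<omega>)) \<le> exp ((exp a - 1) * expectation W)"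
proof -
  have "AE \<omega> in M. norm (W \<omega>) \<le> 1"
    using W by eventually_elim auto
  then have intW: "integrable M W"
    by (intro integrable_const_bound[of _ 1]) simp_all
  show int: "integrable M (\<lambda>\<omega>. exp (a * W \<omega>))"
  proof (rule integrable_const_bound)
    show "AE \<omega> in M. norm (exp (a * W \<omega>)) \<le> exp \<bar>a\<bar>"
      using W
    proof eventually_elim
      case (elim \<omega>)
      have "a * W \<omega> \<le> \<bar>a\<bar> * 1"
        using elim abs_ge_self by (intro mult_mono) auto
      then show ?case by simp
    qed
  qed simp
  have "expectation (\<lambda>\<omega>. exp (a * W \<omega>)) \<le> expectation (\<lambda>\<omega>. 1 + (exp a - 1) * W \<omega>)"
    using int intW W exp_le_chord by (intro integral_mono_AE) auto
  also have "\<dots> = 1 + (exp a - 1) * expectation W"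
    using intW by (simp add: prob_space)
  also have "\<dots> \<le> exp ((exp a - 1) * expectation W)"
    by (rule exp_ge_add_one_self)
  finally show "expectation (\<lambda>\<omega>. exp (a * W \<omega>)) \<le> exp ((exp a - 1) * expectation W)" .
qed

text \<open>The sign of \<open>a\<close> selects the tail: \<open>a = 1\<close> controls the sum
  from above and \<open>a = -1\<close> from below.\<close>

lemma (in prob_space) iid_chernoff:
  fixes T :: "'i \<Rightarrow> 'a \<Rightarrow> 'z::topological_space" and W :: "'z \<Rightarrow> real"
  assumes indep: "indep_vars (\<lambda>_. borel) T I" and fin: "finite I"
    and [measurable]: "T0 \<in> borel_measurable M" "W \<in> borel_measurable borel"
    and distr: "\<And>i. i \<in> I \<Longrightarrow> distr M borel (T i) = distr M borel T0"
    and W: "AE \<omega> in M. 0 \<le> W (T0 \<omega>) \<and> W (T0 \<omega>) \<le> 1"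
  shows "prob {\<omega> \<in> space M. real (card I) * ((exp a - 1) * expectation (\<lambda>\<omega>. W (T0 \<omega>))) + K
      \<le> (\<Sum>i\<in>I. a * W (T i \<omega>))} \<le> exp (- K)"
proof (rule chernoff_sum[OF _ fin])
  show "indep_vars (\<lambda>_. borel) (\<lambda>i \<omega>. a * W (T i \<omega>)) I"
    by (rule indep_vars_compose2[OF indep]) simp
  fix i assume i: "i \<in> I"
  then have [measurable]: "T i \<in> borel_measurable M"
    using indep by (simp add: indep_vars_def)
  have "integrable (distr M borel T0) (\<lambda>z. exp (a * W z))"
    using expectation_exp_le(1)[OF _ W, of a] by (simp add: integrable_distr_eq)
  then show "integrable M (\<lambda>\<omega>. exp (a * W (T i \<omega>)))"
    unfolding distr[OF i, symmetric] by (simp add: integrable_distr_eq)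
  have "expectation (\<lambda>\<omega>. exp (a * W (T i \<omega>))) = (\<integral>z. exp (a * W z) \<partial>distr M borel (T i))"
    by (simp add: integral_distr)
  also have "\<dots> = expectation (\<lambda>\<omega>. exp (a * W (T0 \<omega>)))"
    by (simp add: distr[OF i] integral_distr)
  also have "\<dots> \<le> exp ((exp a - 1) * expectation (\<lambda>\<omega>. W (T0 \<omega>)))"
    using W by (intro expectation_exp_le) simp_all
  finally show "expectation (\<lambda>\<omega>. exp (a * W (T i \<omega>)))
      \<le> exp ((exp a - 1) * expectation (\<lambda>\<omega>. W (T0 \<omega>)))" .
qed

text \<open>The tower property with weight \<open>1\<close>.\<close>

lemma (in prob_space) nn_integral_le_cond_exp_bound:
  assumes sub: "subalgebra M F" and [measurable]: "g \<in> borel_measurable M"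
    and le: "AE \<omega> in M. nn_cond_exp M F g \<omega> \<le> c"
  shows "(\<integral>\<^sup>+\<omega>. g \<omega> \<partial>M) \<le> c"
proof -
  interpret finite_measure_subalgebra M F
    by unfold_locales (rule sub)
  have "(\<integral>\<^sup>+\<omega>. g \<omega> \<partial>M) = (\<integral>\<^sup>+\<omega>. nn_cond_exp M F g \<omega> \<partial>M)"
    using nn_cond_exp_intg[of "\<lambda>_. 1" g] by simp
  also have "\<dots> \<le> (\<integral>\<^sup>+\<omega>. c \<partial>M)"
    using le by (rule nn_integral_mono_AE)
  finally show ?thesis
    by (simp add: emeasure_space_1)
qed

text \<open>The pointwise source bound is integrated; the cross term vanishes because
  \<open>Z\<close> is measurable for the \<open>\<sigma>\<close>-algebra given which
  \<open>\<epsilon>\<close> has mean zero.\<close>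

lemma expectation_bregman_le_source:
  fixes A :: "'v::euclidean_space \<Rightarrow> 'y::{real_inner, banach, second_countable_topology}"
  assumes A: "linear A" and l: "0 < l"
    and [measurable]: "\<epsilon> \<in> borel_measurable M"
    and Y: "AE \<omega> in M. Y \<omega> = A (X \<omega>) + \<epsilon> \<omega>"
    and ce: "has_cond_exp M F \<epsilon> (\<lambda>_. 0)" and Z: "Z \<in> borel_measurable F"
    and source: "AE \<omega> in M. adjoint A (Z \<omega>) \<in> subdifferential J (X \<omega>)"
    and Z2: "(\<integral>\<^sup>+\<omega>. ennreal ((norm (Z \<omega>))\<^sup>2) \<partial>M) \<le> ennreal (\<beta>\<^sup>2)"
    and \<epsilon>2: "(\<integral>\<^sup>+\<omega>. ennreal ((norm (\<epsilon> \<omega>))\<^sup>2) \<partial>M) \<le> ennreal (\<tau>\<^sup>2)"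
    and int: "integrable M (\<lambda>\<omega>. bregman J (opt_subgrad A l (Y \<omega>) (X' \<omega>)) (X \<omega>) (X' \<omega>))"
  shows "(\<integral>\<omega>. bregman J (opt_subgrad A l (Y \<omega>) (X' \<omega>)) (X \<omega>) (X' \<omega>) \<partial>M)
    \<le> (l * \<beta>\<^sup>2 + \<tau>\<^sup>2 / l) / 4"
proof -
  have sub: "subalgebra M F"
    using ce by (simp add: has_cond_exp_def)
  have [measurable]: "Z \<in> borel_measurable M"
    by (rule measurable_from_subalg[OF sub Z])
  have intZ: "integrable M (\<lambda>\<omega>. (norm (Z \<omega>))\<^sup>2)" and leZ: "(\<integral>\<omega>. (norm (Z \<omega>))\<^sup>2 \<partial>M) \<le> \<beta>\<^sup>2"
    by (rule second_moment_le[OF _ Z2]; simp)+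
  have int\<epsilon>: "integrable M (\<lambda>\<omega>. (norm (\<epsilon> \<omega>))\<^sup>2)" and le\<epsilon>: "(\<integral>\<omega>. (norm (\<epsilon> \<omega>))\<^sup>2 \<partial>M) \<le> \<tau>\<^sup>2"
    by (rule second_moment_le[OF _ \<epsilon>2]; simp)+
  have intN: "integrable M (\<lambda>\<omega>. norm (Z \<omega>) * norm (\<epsilon> \<omega>))"
  proof (rule Bochner_Integration.integrable_bound[OF Bochner_Integration.integrable_add[OF intZ int\<epsilon>]])
    have "a * b \<le> a\<^sup>2 + b\<^sup>2" if "0 \<le> a" "0 \<le> b" for a b :: real
      using sum_squares_bound[of a b] mult_nonneg_nonneg[OF that] by linarith
    then show "AE \<omega> in M. norm (norm (Z \<omega>) * norm (\<epsilon> \<omega>))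
        \<le> norm ((norm (Z \<omega>))\<^sup>2 + (norm (\<epsilon> \<omega>))\<^sup>2)"
      by simp
  qed simp
  have intI: "integrable M (\<lambda>\<omega>. Z \<omega> \<bullet> \<epsilon> \<omega>)"
    by (rule Bochner_Integration.integrable_bound[OF intN]) (auto simp: Cauchy_Schwarz_ineq2)
  have "(\<integral>\<omega>. bregman J (opt_subgrad A l (Y \<omega>) (X' \<omega>)) (X \<omega>) (X' \<omega>) \<partial>M)
      \<le> (\<integral>\<omega>. l / 4 * (norm (Z \<omega>))\<^sup>2 - (Z \<omega> \<bullet> \<epsilon> \<omega>) / 2 + (norm (\<epsilon> \<omega>))\<^sup>2 / (4 * l) \<partial>M)"
  proof (rule integral_mono_AE[OF int])
    show "AE \<omega> in M. bregman J (opt_subgrad A l (Y \<omega>) (X' \<omega>)) (X \<omega>) (X' \<omega>)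
        \<le> l / 4 * (norm (Z \<omega>))\<^sup>2 - (Z \<omega> \<bullet> \<epsilon> \<omega>) / 2 + (norm (\<epsilon> \<omega>))\<^sup>2 / (4 * l)"
      using Y source by eventually_elim (simp only: bregman_le_source[OF A l])
  qed (use intZ int\<epsilon> intI in auto)
  also have "\<dots> = l / 4 * (\<integral>\<omega>. (norm (Z \<omega>))\<^sup>2 \<partial>M) + (\<integral>\<omega>. (norm (\<epsilon> \<omega>))\<^sup>2 \<partial>M) / (4 * l)"
    using intZ int\<epsilon> intI integral_inner_cond_exp_zero[OF ce Z intN] by simp
  also have "\<dots> \<le> l / 4 * \<beta>\<^sup>2 + \<tau>\<^sup>2 / (4 * l)"
    using leZ le\<epsilon> l by (intro add_mono mult_left_mono divide_right_mono) auto
  finally show ?thesis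
    by (simp add: field_simps)
qed

section \<open>Elementary inequalities behind the constants\<close>

lemma plus_inverse_mono:
  fixes q Q :: real
  assumes "1 \<le> q" "q \<le> Q"
  shows "q + 1 / q \<le> Q + 1 / Q"
proof -
  have "1 \<le> q * Q"
    using mult_mono[of 1 q 1 Q] assms by simp
  then have "0 \<le> (Q - q) * (q * Q - 1) / (q * Q)"
    using assms by simp
  also have "\<dots> = (Q + 1 / Q) - (q + 1 / q)"
    using assms by (simp add: field_simps)
  finally show ?thesis by simp
qed

text \<open>With \<open>q = \<tau> / (\<beta> * l)\<close>, which lies between \<open>1\<close> and
  \<open>Q\<close>, the left-hand side is \<open>(q + 1 / q) * \<beta> * \<tau>\<close>.\<close>

lemma grid_point_bound:
  fixes l :: real
  assumes pos: "0 < \<beta>" "0 < \<tau>" "0 < l" and l: "l \<le> \<tau> / \<beta>" "\<tau> / \<beta> \<le> Q * l"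
  shows "l * \<beta>\<^sup>2 + \<tau>\<^sup>2 / l \<le> (1 + Q\<^sup>2) / Q * \<beta> * \<tau>"
proof -
  define q where "q = \<tau> / \<beta> / l"
  have q: "1 \<le> q" "q \<le> Q"
    using pos l by (simp_all add: q_def pos_le_divide_eq pos_divide_le_eq mult_ac)
  have "l * \<beta>\<^sup>2 + \<tau>\<^sup>2 / l = (q + 1 / q) * (\<beta> * \<tau>)"
    using pos by (simp add: q_def field_simps power2_eq_square)
  also have "\<dots> \<le> (Q + 1 / Q) * (\<beta> * \<tau>)"
    using plus_inverse_mono[OF q] pos by (intro mult_right_mono) auto
  also have "\<dots> = (1 + Q\<^sup>2) / Q * \<beta> * \<tau>"
    using q by (simp add: field_simps power2_eq_square)
  finally show ?thesis .
qed

text \<open>Here \<open>S\<close> and \<open>S'\<close> are normalized empirical sums at the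
  selected and at a reference parameter, with means \<open>\<mu>\<close> and \<open>\<mu>'\<close>
  per observation. Multiplying by \<open>exp 1\<close> and cancelling \<open>exp 1 - 1\<close>
  isolates \<open>\<mu>\<close>.\<close>

lemma erm_comparison:
  fixes S S' \<mu> \<mu>' K :: real and n :: nat
  assumes n: "1 \<le> n" and K: "0 \<le> K" and SS: "S \<le> S'"
    and lower: "- S < real n * ((exp (-1) - 1) * \<mu>) + K"
    and upper: "S' < real n * ((exp 1 - 1) * \<mu>') + K"
  shows "\<mu> \<le> exp 1 * \<mu>' + 4 * K / real n"
proof -
  define e :: real where "e = exp 1"
  have e: "2 \<le> e"
    using exp_ge_add_one_self[of "1::real"] by (simp add: e_def)
  have "real n * ((1 - 1 / e) * \<mu>) \<le> real n * ((e - 1) * \<mu>') + 2 * K"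
  proof -
    have "real n * ((1 - 1 / e) * \<mu>) = - (real n * ((exp (-1) - 1) * \<mu>))"
      by (simp add: e_def exp_minus inverse_eq_divide algebra_simps)
    then show ?thesis
      using lower upper SS by (simp add: e_def)
  qed
  then have "e * (real n * ((1 - 1 / e) * \<mu>)) \<le> e * (real n * ((e - 1) * \<mu>') + 2 * K)"
    using e by (intro mult_left_mono) auto
  also have "e * (real n * ((1 - 1 / e) * \<mu>)) = (e - 1) * (real n * \<mu>)"
    using e by (simp add: field_simps)
  \<comment> \<open>The factor \<open>4\<close> comes from \<open>2 * e \<le> 4 * (e - 1)\<close>,
    valid since \<open>2 \<le> e\<close>.\<close>
  also have "e * (real n * ((e - 1) * \<mu>') + 2 * K) \<le> (e - 1) * (real n * (e * \<mu>') + 4 * K)"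
    using mult_right_mono[of 2 e K] e K by (simp add: algebra_simps)
  finally have "real n * \<mu> \<le> real n * (e * \<mu>') + 4 * K"
    using e by simp
  then show ?thesis
    using n by (simp add: e_def field_simps)
qed

section \<open>Risk bound for the parameter selected on the grid\<close>

theorem corollary3:
  fixes M :: "'o measure"
    and A :: "real^'d \<Rightarrow> 'y::{real_inner, banach, second_countable_topology}"
    and G :: "real^'d \<Rightarrow> real^'m"
    and p :: "real^'m \<Rightarrow> real"
    and J :: "real^'d \<Rightarrow> real"
    and X :: "'o \<Rightarrow> real^'d"
    and \<epsilon> Y Z :: "'o \<Rightarrow> 'y"
    and \<tau> R \<beta> Q \<eta> :: real
    and N n :: nat
    and lamb :: "nat \<Rightarrow> real"
    and \<Lambda> :: "real set"
    and f :: "real \<Rightarrow> 'y \<Rightarrow> real^'d"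
    and Xi :: "nat \<Rightarrow> 'o \<Rightarrow> real^'d"
    and Yi :: "nat \<Rightarrow> 'o \<Rightarrow> 'y"
    and lamhat :: "'o \<Rightarrow> real"
    and L :: "real \<Rightarrow> real"
  assumes "prob_space M"
    and "linear A" and "onorm A \<le> 1"
    and "X \<in> borel_measurable M" and "\<epsilon> \<in> borel_measurable M" and "Y \<in> borel_measurable M"
    and "AE \<omega> in M. norm (X \<omega>) \<le> 1"
    and "AE \<omega> in M. Y \<omega> = A (X \<omega>) + \<epsilon> \<omega>"
    \<comment> \<open>noise\<close>
    and "has_cond_exp M (sigma_gen M X) \<epsilon> (\<lambda>_. 0)"
    and "\<tau> > 0"
    and "AE \<omega> in M. nn_cond_exp M (sigma_gen M X) (\<lambda>\<omega>. ennreal ((norm (\<epsilon> \<omega>))\<^sup>2)) \<omega> \<le> ennreal (\<tau>\<^sup>2)"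
    \<comment> \<open>regularizer\<close>
    and "is_norm p" and "linear G" and "R > 0" and "onorm_wrt p G \<le> R"
    and "J = (\<lambda>x. p (G x))"
    \<comment> \<open>source condition\<close>
    and "Z \<in> borel_measurable (sigma_gen M X)"
    and "\<beta> > 0"
    and "AE \<omega> in M. adjoint A (Z \<omega>) \<in> subdifferential J (X \<omega>)"
    and "(\<integral>\<^sup>+\<omega>. ennreal ((norm (Z \<omega>))\<^sup>2) \<partial>M) \<le> ennreal (\<beta>\<^sup>2)"
    \<comment> \<open>parameter grid\<close>
    and "N \<ge> 2" and "0 < lamb 1" and "mono_on {1..N} lamb"
    and "Q = (lamb N / lamb 1) powr (1 / (real N - 1))"
    and "\<And>j. j \<in> {1..N} \<Longrightarrow> lamb j = lamb 1 * Q ^ (j - 1)"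
    and "\<Lambda> = lamb ` {1..N}"
    and "\<tau> / \<beta> \<in> {lamb 1..lamb N}"
    \<comment> \<open>regularized solutions\<close>
    and "\<And>l. l > 0 \<Longrightarrow> f l \<in> borel_measurable borel"
    and "\<And>l. l > 0 \<Longrightarrow>
           AE \<omega> in M. is_arg_min (\<lambda>x. 1/2 * (norm (A x - Y \<omega>))\<^sup>2 + l * J x) (\<lambda>_. True) (f l (Y \<omega>))"
    \<comment> \<open>sample\<close>
    and "n \<ge> 1"
    and "\<And>i. i \<in> {1..n} \<Longrightarrow> Xi i \<in> borel_measurable M"
    and "\<And>i. i \<in> {1..n} \<Longrightarrow> Yi i \<in> borel_measurable M"
    and "prob_space.indep_vars M (\<lambda>_. borel) (\<lambda>i \<omega>. (Yi i \<omega>, Xi i \<omega>)) {1..n}"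
    and "\<And>i. i \<in> {1..n} \<Longrightarrow>
           distr M borel (\<lambda>\<omega>. (Yi i \<omega>, Xi i \<omega>)) = distr M borel (\<lambda>\<omega>. (Y \<omega>, X \<omega>))"
    \<comment> \<open>data-driven parameter and risk\<close>
    and "lamhat \<in> borel_measurable M"
    and "\<And>\<omega>. \<omega> \<in> space M \<Longrightarrow>
           is_arg_min
             (\<lambda>l. 1 / real n * (\<Sum>i=1..n.
                bregman J (opt_subgrad A l (Yi i \<omega>) (f l (Yi i \<omega>))) (Xi i \<omega>) (f l (Yi i \<omega>))))
             (\<lambda>l. l \<in> \<Lambda>) (lamhat \<omega>)"
    and "L = (\<lambda>l. \<integral>\<omega>. bregman J (opt_subgrad A l (Y \<omega>) (f l (Y \<omega>))) (X \<omega>) (f l (Y \<omega>)) \<partial>M)"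
    and "0 < \<eta>" and "\<eta> < 1"
  shows "measure M {\<omega> \<in> space M.
           L (lamhat \<omega>) \<le> (1 + Q\<^sup>2) / Q * \<beta> * \<tau> + 13 * R / real n * ln (2 * real N / \<eta>)} \<ge> 1 - \<eta>"
proof -
  interpret prob_space M by fact
  interpret J: bounded_seminorm J R
    unfolding \<open>J = _\<close> by (rule bounded_seminorm_norm_linear) fact+
  note A = \<open>linear A\<close>
  have [measurable]: "X \<in> borel_measurable M" "Y \<in> borel_measurable M" "\<epsilon> \<in> borel_measurable M"
    "lamhat \<in> borel_measurable M"
    by fact+
  have [measurable]: "J \<in> borel_measurable borel" "A \<in> borel_measurable borel"
    using J.continuous linear_continuous_on[of A UNIV] A
    by (auto intro!: borel_measurable_continuous_onI simp: linear_conv_bounded_linear)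
  \<comment> \<open>The divergence as a fixed function of the pair \<open>(y, x)\<close>, so that
    independence and equality of laws of the pairs pass to it.\<close>
  define D where "D l z = bregman J (opt_subgrad A l (fst z) (f l (fst z))) (snd z) (f l (fst z))"
    for l and z :: "'y \<times> (real^'d)"
  have D_meas: "D l \<in> borel_measurable borel" if "0 < l" for l
  proof -
    have [measurable]: "f l \<in> borel_measurable borel"
      using that by fact
    have [measurable]: "(fst :: 'y \<times> (real^'d) \<Rightarrow> 'y) \<in> borel_measurable borel"
      "(snd :: 'y \<times> (real^'d) \<Rightarrow> real^'d) \<in> borel_measurable borel"
      by (intro borel_measurable_continuous_onI continuous_on_fst continuous_on_snd continuous_on_id)+
    show ?thesis
      unfolding D_def[abs_def] bregman_opt_subgrad[OF A] by measurable
  qed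
  have D_bounds: "AE \<omega> in M. 0 \<le> D l (Y \<omega>, X \<omega>) \<and> D l (Y \<omega>, X \<omega>) \<le> 2 * R" if l: "0 < l" for l
    using assms(29)[OF l] \<open>AE \<omega> in M. norm (X \<omega>) \<le> 1\<close>
  proof eventually_elim
    case (elim \<omega>)
    have sg: "opt_subgrad A l (Y \<omega>) (f l (Y \<omega>)) \<in> subdifferential J (f l (Y \<omega>))"
      by (rule opt_subgrad_in_subdifferential[OF J.bounded_seminorm_axioms A l])
        (use elim(1) in \<open>simp add: is_arg_min_def not_less\<close>)
    moreover have "2 * R * norm (X \<omega>) \<le> 2 * R"
      using elim(2) \<open>R > 0\<close> by simp
    ultimately show ?case
      using J.bregman_nonneg[OF sg, of "X \<omega>"] J.bregman_le[OF sg, of "X \<omega>"] by (simp add: D_def)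
  qed
  have L_eq: "L l = expectation (\<lambda>\<omega>. D l (Y \<omega>, X \<omega>))" for l
    by (simp add: \<open>L = _\<close> D_def)
  have "lamb 1 \<le> lamb N"
    using \<open>\<tau> / \<beta> \<in> _\<close> by auto
  then have Q: "1 \<le> Q"
    unfolding \<open>Q = _\<close> using \<open>0 < lamb 1\<close> \<open>N \<ge> 2\<close> by (intro ge_one_powr_ge_zero) auto
  have pos: "0 < lamb j" if "j \<in> {1..N}" for j
    using assms(25)[OF that] \<open>0 < lamb 1\<close> Q by simp
  obtain k where k: "k \<in> {1..N}" "lamb k \<le> \<tau> / \<beta>" "\<tau> / \<beta> \<le> Q * lamb k"
    by (rule geometric_grid_point[OF _ Q \<open>0 < lamb 1\<close> assms(25,27)]) (use \<open>N \<ge> 2\<close> in simp_all)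
  have noise: "(\<integral>\<^sup>+\<omega>. ennreal ((norm (\<epsilon> \<omega>))\<^sup>2) \<partial>M) \<le> ennreal (\<tau>\<^sup>2)"
    using assms(9,11)
    by (intro nn_integral_le_cond_exp_bound[of "sigma_gen M X"]) (auto simp: has_cond_exp_def)
  have [measurable]: "D (lamb k) \<in> borel_measurable borel"
    by (rule D_meas[OF pos[OF k(1)]])
  have "AE \<omega> in M. norm (D (lamb k) (Y \<omega>, X \<omega>)) \<le> 2 * R"
    using D_bounds[OF pos[OF k(1)]] by eventually_elim auto
  then have "integrable M (\<lambda>\<omega>. D (lamb k) (Y \<omega>, X \<omega>))"
    by (intro integrable_const_bound[of _ "2 * R"]) simp_all
  then have "L (lamb k) \<le> (lamb k * \<beta>\<^sup>2 + \<tau>\<^sup>2 / lamb k) / 4"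
    unfolding L_eq D_def fst_conv snd_conv
    by (intro expectation_bregman_le_source[OF A pos[OF k(1)] assms(5,8,9,17,19,20) noise])
  also have "\<dots> \<le> ((1 + Q\<^sup>2) / Q * \<beta> * \<tau>) / 4"
    using grid_point_bound[OF \<open>\<beta> > 0\<close> \<open>\<tau> > 0\<close> pos k(2,3)] k(1) by simp
  \<comment> \<open>The factor \<open>4\<close> gained from the source bound pays for the factor
    \<open>exp 1\<close> lost in the empirical comparison.\<close>
  finally have Lk: "4 * L (lamb k) \<le> (1 + Q\<^sup>2) / Q * \<beta> * \<tau>"
    by (simp only: le_divide_eq_numeral1 mult.commute[of 4])
  have Lk_nonneg: "0 \<le> L (lamb k)"
    unfolding L_eq using D_bounds[OF pos[OF k(1)]] by (intro integral_nonneg_AE) auto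

  \<comment> \<open>Chosen so that \<open>exp (- K)\<close> is \<open>\<eta> / (2 * N)\<close>; a
    union over \<open>N + 1\<close> events of this probability stays below
    \<open>\<eta>\<close>.\<close>
  define K where "K = ln (2 * real N / \<eta>)"
  have "1 \<le> 2 * real N / \<eta>"
    using \<open>\<eta> < 1\<close> \<open>0 < \<eta>\<close> \<open>N \<ge> 2\<close> by (simp add: pos_le_divide_eq)
  then have K: "0 \<le> K" and exp_K: "exp (- K) = \<eta> / (2 * real N)"
    by (simp_all add: K_def exp_minus)
  define W where "W l z = D l z / (2 * R)" for l z
  define S where "S l \<omega> = (\<Sum>i=1..n. W l (Yi i \<omega>, Xi i \<omega>))" for l \<omega>
  \<comment> \<open>The tail event of \<open>S l\<close>, whose mean is
    \<open>n * L l / (2 * R)\<close>: the upper tail for \<open>a = 1\<close>, the lower tail for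
    \<open>a = -1\<close>.\<close>
  define B where "B a l = {\<omega> \<in> space M. real n * ((exp a - 1) * (L l / (2 * R))) + K \<le> a * S l \<omega>}"
    for a l
  have W_meas: "W l \<in> borel_measurable borel" if "0 < l" for l
    using D_meas[OF that] by (simp add: W_def[abs_def])
  have prob_B: "prob (B a l) \<le> \<eta> / (2 * real N)" if l: "0 < l" for a l
  proof -
    have "AE \<omega> in M. 0 \<le> W l (Y \<omega>, X \<omega>) \<and> W l (Y \<omega>, X \<omega>) \<le> 1"
      using D_bounds[OF l] by eventually_elim (use \<open>R > 0\<close> in \<open>simp add: W_def\<close>)
    from iid_chernoff[OF assms(33) _ _ W_meas[OF l] assms(34) this, of a K]
    show ?thesis
      by (simp add: B_def S_def exp_K L_eq W_def sum_distrib_left borel_measurable_Pair)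
  qed
  have B_meas: "B a l \<in> events" if l: "0 < l" for a l
  proof -
    note W_meas[OF l, measurable]
    have [measurable]: "(\<lambda>\<omega>. W l (Yi i \<omega>, Xi i \<omega>)) \<in> borel_measurable M" if "i \<in> {1..n}" for i
      using assms(31,32)[OF that] by measurable
    have "S l \<in> borel_measurable M"
      unfolding S_def by (intro borel_measurable_sum) auto
    then show ?thesis
      unfolding B_def by measurable
  qed
  \<comment> \<open>The selected parameter is random, so the lower tail is excluded at every grid
    point; the reference \<open>lamb k\<close> is fixed, so one upper tail suffices.\<close>
  define Bad where "Bad = B 1 (lamb k) \<union> (\<Union>j\<in>{1..N}. B (-1) (lamb j))"
  have Bad_meas: "Bad \<in> events"
    unfolding Bad_def by (intro sets.Un sets.finite_UN B_meas pos k(1)) auto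
  have "prob Bad \<le> prob (B 1 (lamb k)) + prob (\<Union>j\<in>{1..N}. B (-1) (lamb j))"
    unfolding Bad_def using pos k(1) by (intro measure_Un_le) (auto intro!: B_meas)
  also have "\<dots> \<le> \<eta> / (2 * real N) + (\<Sum>j\<in>{1..N}. \<eta> / (2 * real N))"
    using pos k(1)
    by (intro add_mono prob_B order_trans[OF measure_UNION_le sum_mono]) (auto intro!: B_meas prob_B)
  also have "\<dots> = (real N + 1) * \<eta> / (2 * real N)"
    by (simp add: algebra_simps add_divide_distrib)
  also have "\<dots> \<le> \<eta>"
    using mult_right_mono[of "real N + 1" "2 * real N" \<eta>] \<open>0 < \<eta>\<close> \<open>N \<ge> 2\<close> by (simp add: field_simps)
  finally have "1 - \<eta> \<le> prob (space M - Bad)"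
    by (simp add: prob_compl[OF Bad_meas])
  also have "\<dots> \<le> prob {\<omega> \<in> space M.
      L (lamhat \<omega>) \<le> (1 + Q\<^sup>2) / Q * \<beta> * \<tau> + 13 * R / real n * ln (2 * real N / \<eta>)}"
  proof (rule finite_measure_mono)
    show "space M - Bad \<subseteq> {\<omega> \<in> space M.
      L (lamhat \<omega>) \<le> (1 + Q\<^sup>2) / Q * \<beta> * \<tau> + 13 * R / real n * ln (2 * real N / \<eta>)}"
    proof safe
      fix \<omega> assume \<omega>: "\<omega> \<in> space M" "\<omega> \<notin> Bad"
      \<comment> \<open>The empirical risk is a positive multiple of \<open>S l\<close>, so
        \<open>lamhat\<close> minimizes \<open>S\<close> over the grid.\<close>
      have emp: "1 / real n * (\<Sum>i=1..n. bregman J (opt_subgrad A l (Yi i \<omega>) (f l (Yi i \<omega>)))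
          (Xi i \<omega>) (f l (Yi i \<omega>))) = 2 * R / real n * S l \<omega>" for l
        using \<open>R > 0\<close> by (simp add: S_def W_def D_def flip: sum_divide_distrib)
      have hat: "lamhat \<omega> \<in> \<Lambda>" and "\<not> 2 * R / real n * S (lamb k) \<omega> < 2 * R / real n * S (lamhat \<omega>) \<omega>"
        using assms(36)[OF \<omega>(1)] k(1) unfolding emp is_arg_min_def \<open>\<Lambda> = _\<close> by blast+
      then have "S (lamhat \<omega>) \<omega> \<le> S (lamb k) \<omega>"
        using \<open>R > 0\<close> \<open>n \<ge> 1\<close> by (simp add: not_less divide_le_cancel)
      moreover obtain j where j: "j \<in> {1..N}" "lamhat \<omega> = lamb j"
        using hat unfolding \<open>\<Lambda> = _\<close> by auto
      ultimately have "L (lamb j) / (2 * R) \<le> exp 1 * (L (lamb k) / (2 * R)) + 4 * K / real n"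
        using \<omega> \<open>n \<ge> 1\<close> K by (intro erm_comparison) (auto simp: Bad_def B_def not_le)
      \<comment> \<open>Undoing the normalization by \<open>2 * R\<close> turns
        \<open>4 * K / n\<close> into \<open>8 * R / n * K\<close>.\<close>
      then have "2 * R * (L (lamb j) / (2 * R))
          \<le> 2 * R * (exp 1 * (L (lamb k) / (2 * R)) + 4 * K / real n)"
        using \<open>R > 0\<close> by (intro mult_left_mono) auto
      then have "L (lamb j) \<le> exp 1 * L (lamb k) + 8 * R / real n * K"
        using \<open>R > 0\<close> by (simp add: algebra_simps)
      also have "\<dots> \<le> 4 * L (lamb k) + 13 * R / real n * K"
        using exp_le Lk_nonneg K \<open>R > 0\<close>
        by (intro add_mono mult_right_mono divide_right_mono) auto
      finally show "L (lamhat \<omega>) \<le> (1 + Q\<^sup>2) / Q * \<beta> * \<tau> + 13 * R / real n * ln (2 * real N / \<eta>)"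
        using Lk by (simp add: j K_def)
    qed
    \<comment> \<open>As \<open>lamhat\<close> takes only finitely many values, the event is a
      finite union of its level sets and hence measurable.\<close>
    have "(\<Union>j\<in>{j \<in> {1..N}. L (lamb j) \<le> c}. {\<omega> \<in> space M. lamhat \<omega> = lamb j}) \<in> events" for c
      by measurable
    moreover have "{\<omega> \<in> space M. L (lamhat \<omega>) \<le> c}
        = (\<Union>j\<in>{j \<in> {1..N}. L (lamb j) \<le> c}. {\<omega> \<in> space M. lamhat \<omega> = lamb j})" for c
      using assms(36) unfolding is_arg_min_def \<open>\<Lambda> = _\<close> by fastforce
    ultimately show "{\<omega> \<in> space M.
      L (lamhat \<omega>) \<le> (1 + Q\<^sup>2) / Q * \<beta> * \<tau> + 13 * R / real n * ln (2 * real N / \<eta>)} \<in> events"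
      by simp
  qed
  finally show ?thesis .
qed

end
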